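(* For $1\le N\le 2^n$ let $E_\lambda(n,N)=\max\{E_\lambda(Z): Z\subset\{0,1\}^n,\ |Z|=N\}$. Then for every $N\ge1$, $E_\lambda(n,N)\le(N-1)\lambda(n)$. If $n=2t-1$, then $$E_\lambda(n,N)\le\begin{cases}\lambda(t)\big(N-\tfrac12\big), & t\text{ even},\\[2pt] \frac{\lambda(t)}{n+1}\big(Nn-\tfrac{n-1}2\big), & t\text{ odd}.\end{cases}$$ If $n$ is odd, then $$E_\lambda(n,N)\le N\hat\lambda_0+(2^n-N)\hat\lambda_{\frac{n+1}2}=N\Lambda_n-\Big(1-\frac N{2^n}\Big)\binom{n-1}{\frac{n-1}2}.$$
   Context: $d$ is the Hamming distance on $\{0,1\}^n$; $\lambda(w)=2^{n-w}w\binom{w-1}{\lceil w/2\rceil-1}$ for $1\le w\le n$ and $\lambda(0)=0$ (this is the value of $\frac12\sum_u|d(x,u)-d(y,u)|$ when $d(x,y)=w$). For $Z=\{z_1,\dots,z_N\}$, $E_\lambda(Z)=\frac1N\sum_{i,j=1}^N\lambda(d(z_i,z_j))$. $\Lambda_n=\hat\lambda_0=\frac n{2^{n+1}}\binom{2n}n$, and $\hat\lambda_k=-2^{-n}\sum_{s=0}^{n-1}(K_s^{(n-1)}(k-1))^2$ for $k\ge1$, with Krawtchouk polynomials $K_k^{(m)}(x)=\sum_{i=0}^k(-1)^i\binom xi\binom{m-x}{k-i}$. *)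

theory Defs
  imports "HOL-Analysis.Analysis"
begin

definition cube :: "nat \<Rightarrow> (nat \<Rightarrow> nat) set" where
  "cube n = {..<n} \<rightarrow>\<^sub>E {0, 1}"

definition hamming :: "nat \<Rightarrow> (nat \<Rightarrow> nat) \<Rightarrow> (nat \<Rightarrow> nat) \<Rightarrow> nat" where
  "hamming n x y = card {i. i < n \<and> x i \<noteq> y i}"

(* Meaningful for w \<le> n only: beyond that the subtraction n - w truncates. *)
definition lam :: "nat \<Rightarrow> nat \<Rightarrow> real" where
  "lam n w = (if w = 0 then 0
     else 2 ^ (n - w) * real w * real ((w - 1) choose (nat \<lceil>real w / 2\<rceil> - 1)))"

definition energy :: "nat \<Rightarrow> (nat \<Rightarrow> nat) set \<Rightarrow> real" where
  "energy n Z = (1 / real (card Z)) * (\<Sum>x\<in>Z. \<Sum>y\<in>Z. lam n (hamming n x y))"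

(* For 1 \<le> N \<le> 2 ^ n the set is finite and nonempty, so Max is a genuine maximum. *)
definition max_energy :: "nat \<Rightarrow> nat \<Rightarrow> real" where
  "max_energy n N = Max {energy n Z | Z. Z \<subseteq> cube n \<and> card Z = N}"

definition krawtchouk :: "nat \<Rightarrow> nat \<Rightarrow> real \<Rightarrow> real" where
  "krawtchouk m k x = (\<Sum>i\<le>k. (-1) ^ i * (x gchoose i) * ((real m - x) gchoose (k - i)))"

definition Lambda :: "nat \<Rightarrow> real" where
  "Lambda n = real n / 2 ^ (n + 1) * real ((2 * n) choose n)"

definition lam_hat :: "nat \<Rightarrow> nat \<Rightarrow> real" where
  "lam_hat n k = (if k = 0 then Lambda n
     else - (1 / 2 ^ n) * (\<Sum>s<n. (krawtchouk (n - 1) s (real k - 1))\<^sup>2))"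

lemma finite_cube: "finite (cube n)"
  unfolding cube_def by (intro finite_PiE) auto

lemma card_cube: "card (cube n) = 2 ^ n"
  unfolding cube_def by (simp add: card_PiE numeral_2_eq_2)

lemma max_energy_attained:
  assumes "N \<le> 2 ^ n"
  shows "finite {energy n Z | Z. Z \<subseteq> cube n \<and> card Z = N}"
    and "{energy n Z | Z. Z \<subseteq> cube n \<and> card Z = N} \<noteq> {}"
proof -
  have "{energy n Z | Z. Z \<subseteq> cube n \<and> card Z = N} \<subseteq> energy n ` Pow (cube n)"
    by auto
  then show "finite {energy n Z | Z. Z \<subseteq> cube n \<and> card Z = N}"
    by (rule finite_subset) (simp add: finite_cube)
  obtain Z where "Z \<subseteq> cube n" "card Z = N"
    using obtain_subset_with_card_n[of N "cube n"] assms by (auto simp: card_cube)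
  then show "{energy n Z | Z. Z \<subseteq> cube n \<and> card Z = N} \<noteq> {}"
    by auto
qed

end

theory Submission
  imports Defs "HOL-Computational_Algebra.Polynomial"
begin

text \<open>
  Points of the cube are coded by subsets of \<open>{..<n}\<close>, so that Hamming distance becomes the size of
  a symmetric difference.

  With \<open>c\<^sub>i = 4\<^sup>-\<^sup>i (2i choose i)\<close> one has \<open>\<lambda>(2i - 1) = \<lambda>(2i) = 2\<^sup>n i c\<^sub>i\<close>, and this is increasing
  and concave in \<open>i\<close>, with increments \<open>2\<^sup>n c\<^sub>i / 2\<close>. Monotonicity gives the first bound. Its tangent at
  \<open>i = t div 2\<close> is \<open>a - b (K\<^sub>1(w) + K\<^sub>n(w))\<close> with \<open>b \<ge> 0\<close>; since \<open>K\<^sub>1\<close> and \<open>K\<^sub>n\<close> are positive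
  definite, this is a linear programming certificate for the second bound.

  For the third bound, \<open>\<lambda>(d(x,y))\<close> is half the sum over centres \<open>u\<close> and radii \<open>r < n\<close> of the squared
  difference of the indicators of \<open>d(x,u) \<le> r\<close> and \<open>d(y,u) \<le> r\<close> (Stolarsky's principle). Parseval's
  identity diagonalises the resulting quadratic form; its nontrivial eigenvalues are minus the sums of
  squared coefficients of \<open>q(z) = (1 - z)\<^sup>j (1 + z)\<^sup>n\<^sup>-\<^sup>1\<^sup>-\<^sup>j\<close>, up to \<open>2\<^sup>-\<^sup>n\<close>. Such a sum is at least the
  absolute value of the alternating sum of the squares, which does not depend on \<open>j\<close>, and equality
  holds in the middle, where \<open>q\<close> is even.
\<close>

subsection \<open>The function \<open>\<lambda>\<close> and central binomial coefficients\<close>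

definition central :: "nat \<Rightarrow> real" where
  "central i = real ((2 * i) choose i) / 4 ^ i"

lemma central_pos: "central i > 0"
  by (simp add: central_def)

lemma central_Suc: "2 * (real i + 1) * central (Suc i) = (2 * real i + 1) * central i"
proof -
  have sym: "(2 * i + 1) choose Suc i = (2 * i + 1) choose i"
    using binomial_symmetric[of i "2 * i + 1"] by simp
  have "(2 * Suc i) choose Suc i = 2 * ((2 * i + 1) choose i)"
    using sym by simp
  moreover have "Suc i * ((2 * i + 1) choose i) = (2 * i + 1) * ((2 * i) choose i)"
    using Suc_times_binomial[of i "2 * i"] sym by simp
  ultimately have "Suc i * ((2 * Suc i) choose Suc i) = 2 * ((2 * i + 1) * ((2 * i) choose i))"
    by (metis mult.left_commute)
  from arg_cong[OF this, of real]
  have "(real i + 1) * real ((2 * Suc i) choose Suc i) = 2 * ((2 * real i + 1) * real ((2 * i) choose i))"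
    unfolding of_nat_mult by (simp del: binomial_Suc_Suc mult_Suc_right add: add.commute)
  moreover have "2 * (real i + 1) * central (Suc i)
      = 2 * ((real i + 1) * real ((2 * Suc i) choose Suc i)) / (4 * 4 ^ i)"
    by (simp only: central_def power_Suc times_divide_eq_right mult.assoc)
  ultimately show ?thesis
    by (simp add: central_def)
qed

text \<open>The increment \<open>central i / 2\<close> is positive, which gives monotonicity, and
  decreasing in \<open>i\<close>, which gives concavity.\<close>

lemma central_weighted_Suc:
  "real (Suc i) * central (Suc i) = real i * central i + central i / 2"
  using central_Suc[of i] by (simp add: algebra_simps)

lemma central_antimono:
  assumes "i \<le> j"
  shows "central j \<le> central i"
proof (rule lift_Suc_antimono_le[OF _ assms])
  fix k
  have "2 * (real k + 1) * central (Suc k) \<le> 2 * (real k + 1) * central k"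
    using central_Suc[of k] central_pos[of k] by (simp add: algebra_simps)
  then show "central (Suc k) \<le> central k"
    by (simp add: mult_le_cancel_left)
qed

lemma central_weighted_mono:
  assumes "i \<le> j"
  shows "real i * central i \<le> real j * central j"
  using central_weighted_Suc less_imp_le[OF central_pos]
  by (intro lift_Suc_mono_le[OF _ assms, of "\<lambda>i. real i * central i"]) simp

text \<open>The right-hand side is the line of slope \<open>central s / 2\<close> through the value
  at \<open>s\<close>. Increments from \<open>s\<close> on are at most this slope and earlier ones
  at least it, so the induction runs away from \<open>s\<close> in both directions. The line also
  meets the value at \<open>s + 1\<close>.\<close>

lemma central_tangent: "real i * central i \<le> central s * (real s + real i) / 2"
proof (cases "s \<le> i")
  case True
  then show ?thesis
  proof (induction i rule: dec_induct)
    case (step i)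
    then show ?case
      using central_weighted_Suc[of i] central_antimono[of s i] by (simp add: algebra_simps)
  qed (simp add: algebra_simps)
next
  case False
  then have "i \<le> s" by simp
  then show ?thesis
  proof (induction i rule: inc_induct)
    case (step i)
    then show ?case
      using central_weighted_Suc[of i] central_antimono[of i s] by (simp add: algebra_simps)
  qed (simp add: algebra_simps)
qed

text \<open>For odd \<open>w = 2k - 1\<close>, Pascal's rule and symmetry give
  \<open>(2k choose k) = 2 (w choose k)\<close>, so both parities share one formula.\<close>

lemma central_eq_binomial:
  assumes "k = (w + 1) div 2"
  shows "real k * real (w choose k) = 2 ^ w * (real k * central k)"
proof (cases "even w")
  case True
  then have "w = 2 * k" using assms by auto
  then show ?thesis by (simp add: central_def power_mult)
next
  case False
  then obtain h where h: "w = 2 * h + 1" by (elim oddE)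
  then have k: "k = Suc h" using assms by simp
  have "(2 * Suc h) choose Suc h = (w choose h) + (w choose Suc h)"
    using h by simp
  moreover have "w choose h = w choose Suc h"
    using binomial_symmetric[of h w] h by simp
  ultimately have "real ((2 * Suc h) choose Suc h) = 2 * real (w choose Suc h)"
    by simp
  then show ?thesis
    by (simp add: central_def k h power_mult)
qed

lemma lam_eq_central:
  assumes "w \<le> n"
  shows "lam n w = 2 ^ n * (real ((w + 1) div 2) * central ((w + 1) div 2))"
proof (cases "w = 0")
  case False
  define k where "k = (w + 1) div 2"
  have "nat \<lceil>real w / 2\<rceil> = k"
  proof -
    have "\<lceil>real w / 2\<rceil> = int k"
      unfolding k_def by (rule ceiling_unique) linarith+
    then show ?thesis by simp
  qed
  \<comment> \<open>Absorption brings the binomial coefficient of \<open>lam\<close> into the form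
    treated by \<open>central_eq_binomial\<close>.\<close>
  moreover have "k * (w choose k) = w * ((w - 1) choose (k - 1))"
    using False times_binomial_minus1_eq[of k w] by (simp add: k_def)
  then have "real w * real ((w - 1) choose (k - 1)) = real k * real (w choose k)"
    by (metis of_nat_mult)
  ultimately have "lam n w = 2 ^ (n - w) * (2 ^ w * (real k * central k))"
    using False central_eq_binomial[OF k_def] by (simp add: lam_def mult.assoc)
  then show ?thesis
    using assms by (simp add: k_def power_diff)
qed (simp add: lam_def)

section \<open>Binomial sums and sums over subsets\<close>

definition binomial_sum :: "nat \<Rightarrow> (nat \<Rightarrow> real) \<Rightarrow> real" where
  "binomial_sum w g = (\<Sum>j\<le>w. real (w choose j) * g j)"

lemma binomial_sum_0: "binomial_sum 0 g = g 0"
  by (simp add: binomial_sum_def)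

lemma binomial_sum_Suc:
  "binomial_sum (Suc w) g = binomial_sum w g + binomial_sum w (\<lambda>j. g (Suc j))"
proof -
  have "(\<Sum>j\<le>w. real (w choose Suc j) * g (Suc j)) + g 0 = (\<Sum>j\<le>Suc w. real (w choose j) * g j)"
    unfolding sum.atMost_Suc_shift by simp
  then have "(\<Sum>j\<le>w. real (w choose Suc j) * g (Suc j)) + g 0 = binomial_sum w g"
    by (simp add: binomial_sum_def)
  then show ?thesis
    unfolding binomial_sum_def[of "Suc w"] sum.atMost_Suc_shift
    by (simp add: binomial_sum_def algebra_simps sum.distrib)
qed

text \<open>Vandermonde's convolution: choosing from two disjoint sets of sizes \<open>m\<close> and
  \<open>n\<close> is choosing from their union.\<close>

lemma binomial_sum_add:
  "binomial_sum m (\<lambda>a. binomial_sum n (\<lambda>b. g (a + b))) = binomial_sum (m + n) g"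
proof (induction m arbitrary: g)
  case (Suc m)
  show ?case
    using Suc.IH[of g] Suc.IH[of "\<lambda>j. g (Suc j)"] by (simp add: binomial_sum_Suc)
qed (simp add: binomial_sum_0)

lemma binomial_sum_reflect: "binomial_sum n (\<lambda>j. g (n - j)) = binomial_sum n g"
  unfolding binomial_sum_def
  by (rule sum.reindex_bij_witness[of _ "\<lambda>j. n - j" "\<lambda>j. n - j"])
    (auto simp: binomial_symmetric[symmetric])

lemma sum_Pow_insert:
  assumes "finite D" "x \<notin> D"
  shows "(\<Sum>V\<in>Pow (insert x D). h V) = (\<Sum>V\<in>Pow D. h V) + (\<Sum>V\<in>Pow D. h (insert x V))"
proof -
  have "inj_on (insert x) (Pow D)"
    using assms(2) by (auto simp: inj_on_def)
  moreover have "Pow D \<inter> insert x ` Pow D = {}"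
    using assms(2) by auto
  ultimately show ?thesis
    using assms(1) by (simp add: Pow_insert sum.union_disjoint sum.reindex)
qed

lemma sum_Pow_card:
  assumes "finite D"
  shows "(\<Sum>V\<in>Pow D. g (card V)) = binomial_sum (card D) g"
  using assms
proof (induction D arbitrary: g rule: finite_induct)
  case (insert x D)
  have "(\<Sum>V\<in>Pow D. g (card (insert x V))) = (\<Sum>V\<in>Pow D. g (Suc (card V)))"
    using insert.hyps by (intro sum.cong refl) (metis PowD card_insert_disjoint finite_subset subsetD)
  then show ?case
    using insert by (simp add: sum_Pow_insert binomial_sum_Suc)
qed (simp add: binomial_sum_0)

text \<open>Each subset of \<open>D\<close> is the trace of exactly \<open>2 ^ card E\<close>
  subsets of the union.\<close>

lemma sum_Pow_Int:
  fixes g :: "'a set \<Rightarrow> real"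
  assumes "finite E" "finite D" "D \<inter> E = {}"
  shows "(\<Sum>V\<in>Pow (D \<union> E). g (V \<inter> D)) = 2 ^ card E * (\<Sum>V\<in>Pow D. g V)"
  using assms
proof (induction E rule: finite_induct)
  case empty
  then show ?case by (auto intro!: sum.cong arg_cong[of _ _ g])
next
  case (insert x E)
  then have "x \<notin> D" by auto
  then have "insert x V \<inter> D = V \<inter> D" for V by auto
  with insert show ?case
    by (simp add: sum_Pow_insert)
qed

lemma binomial_sum_abs:
  "binomial_sum w (\<lambda>j. \<bar>2 * real j - real w\<bar>)
     = 2 ^ (w + 1) * (real ((w + 1) div 2) * central ((w + 1) div 2))"
proof -
  define k where "k = (w + 1) div 2"
  define f where "f j = real (w choose j) * (real w - 2 * real j)" for j
  \<comment> \<open>The closed form vanishes at \<open>p = w + 1\<close>. Since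
    \<open>w - 2j\<close> changes sign at \<open>k\<close>, the absolute sum is twice the partial
    sum below \<open>k\<close> minus the full sum, which is 0.\<close>
  have partial: "(\<Sum>j<p. f j) = real p * real (w choose p)" for p
  proof (cases p)
    case (Suc q)
    have "(\<Sum>j\<le>q. f j) = 2 * (\<Sum>j\<le>q. (real w gchoose j) * (real w / 2 - real j))"
      unfolding f_def sum_distrib_left
      by (intro sum.cong refl) (simp add: binomial_gbinomial algebra_simps)
    also have "\<dots> = real p * real (w choose p)"
      using Suc by (simp add: gbinomial_partial_row_sum binomial_gbinomial)
    finally show ?thesis
      using Suc by (simp add: lessThan_Suc_atMost)
  qed simp
  have "(\<Sum>j<Suc w. real (w choose j) * \<bar>2 * real j - real w\<bar>)
      = (\<Sum>j<Suc w. 2 * (if j < k then f j else 0) - f j)"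
    by (intro sum.cong refl) (auto simp: f_def k_def algebra_simps)
  also have "\<dots> = 2 * (\<Sum>j<Suc w. if j < k then f j else 0) - (\<Sum>j<Suc w. f j)"
    by (simp add: sum_subtractf sum_distrib_left)
  also have "(\<Sum>j<Suc w. if j < k then f j else 0) = (\<Sum>j\<in>{..<Suc w} \<inter> {j. j < k}. f j)"
    by (simp add: sum.inter_restrict)
  also have "{..<Suc w} \<inter> {j. j < k} = {..<k}"
    by (auto simp: k_def)
  finally show ?thesis
    unfolding binomial_sum_def partial k_def[symmetric] lessThan_Suc_atMost[symmetric]
    using central_eq_binomial[OF k_def] by simp
qed

subsection \<open>Stolarsky's principle\<close>

lemma sum_Pow_sym_diff:
  assumes "X \<subseteq> S"
  shows "(\<Sum>U\<in>Pow S. h (sym_diff X U)) = (\<Sum>V\<in>Pow S. h V)"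
  using assms
  by (intro sum.reindex_bij_witness[of _ "sym_diff X" "sym_diff X"])
    (auto intro!: arg_cong[of _ _ h])

lemma card_sym_diff:
  assumes "finite D" "finite V"
  shows "real (card (sym_diff D V)) = real (card V) + real (card D) - 2 * real (card (V \<inter> D))"
proof -
  have "card (sym_diff D V) = card (D - V) + card (V - D)"
    using assms by (intro card_Un_disjoint) auto
  moreover have "card D = card (D - V) + card (V \<inter> D)"
    using assms card_Diff_subset_Int[of D V] card_mono[of D "D \<inter> V"] by (simp add: Int_commute)
  moreover have "card V = card (V - D) + card (V \<inter> D)"
    using assms card_Diff_subset_Int[of V D] card_mono[of V "V \<inter> D"] by simp
  ultimately show ?thesis by simp
qed

text \<open>Recovers the geometric meaning of \<open>lam\<close>, on which Stolarsky's principle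
  rests.\<close>

lemma sum_abs_diff_card_sym_diff:
  assumes "X \<subseteq> {..<n}" "Y \<subseteq> {..<n}"
  shows "(\<Sum>U\<in>Pow {..<n}. \<bar>real (card (sym_diff X U)) - real (card (sym_diff Y U))\<bar>)
    = 2 * lam n (card (sym_diff X Y))"
proof -
  define D where "D = sym_diff X Y"
  define E where "E = {..<n} - D"
  have D: "D \<subseteq> {..<n}" "finite D" and E: "finite E" "D \<inter> E = {}" "D \<union> E = {..<n}"
    using assms by (auto simp: D_def E_def finite_subset[OF _ finite_lessThan[of n]])
  have n: "card D \<le> n"
    using card_mono[OF _ D(1)] by simp
  have cE: "card E = n - card D"
    using D by (simp add: E_def card_Diff_subset)
  \<comment> \<open>Substituting \<open>V = sym_diff X U\<close> moves \<open>X\<close> to the empty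
    set and \<open>Y\<close> to \<open>D\<close>.\<close>
  have YU: "sym_diff Y U = sym_diff D (sym_diff X U)" for U
    by (auto simp: D_def)
  have "(\<Sum>U\<in>Pow {..<n}. \<bar>real (card (sym_diff X U)) - real (card (sym_diff Y U))\<bar>)
      = (\<Sum>V\<in>Pow {..<n}. \<bar>real (card V) - real (card (sym_diff D V))\<bar>)"
    unfolding YU
    by (rule sum_Pow_sym_diff[OF assms(1), where h="\<lambda>V. \<bar>real (card V) - real (card (sym_diff D V))\<bar>"])
  \<comment> \<open>The difference of sizes depends only on the trace of \<open>V\<close> on
    \<open>D\<close>, so each coordinate outside \<open>D\<close> contributes just a factor
    2.\<close>
  also have "\<dots> = (\<Sum>V\<in>Pow (D \<union> E). \<bar>2 * real (card (V \<inter> D)) - real (card D)\<bar>)"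
    unfolding E(3) using D finite_subset[OF _ finite_lessThan[of n]]
    by (intro sum.cong refl, subst card_sym_diff) auto
  also have "\<dots> = 2 ^ card E * (\<Sum>V\<in>Pow D. \<bar>2 * real (card V) - real (card D)\<bar>)"
    using D E by (intro sum_Pow_Int) auto
  also have "\<dots> = 2 ^ card E * binomial_sum (card D) (\<lambda>j. \<bar>2 * real j - real (card D)\<bar>)"
    using sum_Pow_card[OF D(2), of "\<lambda>j. \<bar>2 * real j - real (card D)\<bar>"] by simp
  also have "\<dots> = 2 * lam n (card D)"
    using n by (simp add: binomial_sum_abs lam_eq_central cE power_diff)
  finally show ?thesis by (simp add: D_def)
qed

text \<open>A threshold \<open>t\<close> separates \<open>a\<close> from \<open>b\<close> iff
  \<open>min a b \<le> t < max a b\<close>; as both are at most \<open>n\<close>, all of these lie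
  below \<open>n\<close>.\<close>

lemma abs_diff_eq_sum_thresholds:
  assumes "a \<le> n" "b \<le> n"
  shows "\<bar>real a - real b\<bar> = (\<Sum>t<n. (of_bool (a \<le> t) - of_bool (b \<le> t))\<^sup>2)"
proof -
  have "(\<Sum>t<n. (of_bool (a \<le> t) - of_bool (b \<le> t) :: real)\<^sup>2)
      = (\<Sum>t<n. of_bool (t \<in> {min a b..<max a b}))"
    by (intro sum.cong refl) auto
  also have "\<dots> = real (card ({..<n} \<inter> {min a b..<max a b}))"
    by (simp add: sum.If_cases of_bool_def Int_def)
  also have "{..<n} \<inter> {min a b..<max a b} = {min a b..<max a b}"
    using assms by auto
  finally show ?thesis by (simp add: min_def max_def)
qed

lemma sum_sum_diff_square:
  fixes f :: "'a \<Rightarrow> real"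
  shows "(\<Sum>x\<in>W. \<Sum>y\<in>W. (f x - f y)\<^sup>2) = 2 * (real (card W) * (\<Sum>x\<in>W. (f x)\<^sup>2) - (\<Sum>x\<in>W. f x)\<^sup>2)"
proof -
  have "(\<Sum>x\<in>W. \<Sum>y\<in>W. f x * f y) = (\<Sum>x\<in>W. f x)\<^sup>2"
    by (simp add: power2_eq_square sum_product)
  then show ?thesis
    by (simp add: power2_diff sum.distrib sum_subtractf sum_distrib_left[symmetric] mult.assoc)
qed

lemma sum_abs_diff_thresholds:
  fixes d :: "'a \<Rightarrow> nat"
  assumes "\<And>x. x \<in> W \<Longrightarrow> d x \<le> n"
  shows "(\<Sum>x\<in>W. \<Sum>y\<in>W. \<bar>real (d x) - real (d y)\<bar>)
    = 2 * (\<Sum>t<n. real (card W) * (\<Sum>x\<in>W. of_bool (d x \<le> t)) - (\<Sum>x\<in>W. of_bool (d x \<le> t))\<^sup>2)"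
proof -
  have sq: "(of_bool P :: real)\<^sup>2 = of_bool P" for P by simp
  have "(\<Sum>x\<in>W. \<Sum>y\<in>W. \<bar>real (d x) - real (d y)\<bar>)
      = (\<Sum>x\<in>W. \<Sum>y\<in>W. \<Sum>t<n. (of_bool (d x \<le> t) - of_bool (d y \<le> t))\<^sup>2)"
    using assms by (intro sum.cong refl abs_diff_eq_sum_thresholds) auto
  also have "\<dots> = (\<Sum>x\<in>W. \<Sum>t<n. \<Sum>y\<in>W. (of_bool (d x \<le> t) - of_bool (d y \<le> t))\<^sup>2)"
    by (intro sum.cong refl sum.swap)
  also have "\<dots> = (\<Sum>t<n. \<Sum>x\<in>W. \<Sum>y\<in>W. (of_bool (d x \<le> t) - of_bool (d y \<le> t))\<^sup>2)"
    by (rule sum.swap)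
  finally show ?thesis
    unfolding sum_sum_diff_square sq sum_distrib_left .
qed

definition ball_count :: "nat \<Rightarrow> nat \<Rightarrow> real" where
  "ball_count n t = (\<Sum>V\<in>Pow {..<n}. of_bool (card V \<le> t))"

definition code_ball_count :: "nat set set \<Rightarrow> nat \<Rightarrow> nat set \<Rightarrow> real" where
  "code_ball_count W t U = (\<Sum>X\<in>W. of_bool (card (sym_diff X U) \<le> t))"

lemma sum_code_ball_count:
  assumes "W \<subseteq> Pow {..<n}"
  shows "(\<Sum>U\<in>Pow {..<n}. code_ball_count W t U) = real (card W) * ball_count n t"
proof -
  have "(\<Sum>U\<in>Pow {..<n}. code_ball_count W t U)
      = (\<Sum>X\<in>W. \<Sum>U\<in>Pow {..<n}. of_bool (card (sym_diff X U) \<le> t))"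
    unfolding code_ball_count_def by (rule sum.swap)
  also have "\<dots> = (\<Sum>X\<in>W. ball_count n t)"
    unfolding ball_count_def using assms
    by (intro sum.cong refl sum_Pow_sym_diff[where h="\<lambda>V. of_bool (card V \<le> t)"]) auto
  finally show ?thesis by simp
qed

text \<open>Thresholds turn each difference of distances into squared differences of ball
  indicators. Beyond the size of \<open>W\<close>, only the sum of squared ball counts remains, so
  large energy means small quadratic discrepancy.\<close>

lemma sum_lam_eq_discrepancy:
  assumes "W \<subseteq> Pow {..<n}"
  shows "(\<Sum>X\<in>W. \<Sum>Y\<in>W. lam n (card (sym_diff X Y)))
    = (\<Sum>t<n. (real (card W))\<^sup>2 * ball_count n t - (\<Sum>U\<in>Pow {..<n}. (code_ball_count W t U)\<^sup>2))"
proof -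
  have le: "card (sym_diff X U) \<le> n" if "X \<in> W" "U \<in> Pow {..<n}" for X U
  proof -
    have "sym_diff X U \<subseteq> {..<n}" using that assms by auto
    then show ?thesis using card_mono[OF finite_lessThan] by fastforce
  qed
  have "2 * (\<Sum>X\<in>W. \<Sum>Y\<in>W. lam n (card (sym_diff X Y)))
      = (\<Sum>X\<in>W. \<Sum>Y\<in>W. \<Sum>U\<in>Pow {..<n}. \<bar>real (card (sym_diff X U)) - real (card (sym_diff Y U))\<bar>)"
    unfolding sum_distrib_left using assms
    by (intro sum.cong refl sum_abs_diff_card_sym_diff[symmetric]) auto
  also have "\<dots> = (\<Sum>X\<in>W. \<Sum>U\<in>Pow {..<n}. \<Sum>Y\<in>W. \<bar>real (card (sym_diff X U)) - real (card (sym_diff Y U))\<bar>)"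
    by (intro sum.cong refl sum.swap)
  also have "\<dots> = (\<Sum>U\<in>Pow {..<n}. \<Sum>X\<in>W. \<Sum>Y\<in>W. \<bar>real (card (sym_diff X U)) - real (card (sym_diff Y U))\<bar>)"
    by (rule sum.swap)
  also have "\<dots> = (\<Sum>U\<in>Pow {..<n}. 2 * (\<Sum>t<n. real (card W) * code_ball_count W t U - (code_ball_count W t U)\<^sup>2))"
    unfolding code_ball_count_def using le by (intro sum.cong refl sum_abs_diff_thresholds) auto
  also have "\<dots> = 2 * (\<Sum>t<n. \<Sum>U\<in>Pow {..<n}. real (card W) * code_ball_count W t U - (code_ball_count W t U)\<^sup>2)"
    unfolding sum_distrib_left[symmetric] by (subst sum.swap) simp
  finally show ?thesis
    using sum_code_ball_count[OF assms]
    by (simp add: sum_subtractf sum_distrib_left[symmetric] power2_eq_square mult.assoc)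
qed

text \<open>The left-hand side is half the double sum of differences of subset sizes over the whole
  cube. It supplies the constant \<open>Lambda n\<close> in the spectral bound.\<close>

lemma sum_ball_count:
  "(\<Sum>t<n. 2 ^ n * ball_count n t - (ball_count n t)\<^sup>2) = 2 ^ n * Lambda n"
proof -
  let ?S = "{..<n}"
  have "2 * (\<Sum>t<n. real (card (Pow ?S)) * ball_count n t - (ball_count n t)\<^sup>2)
      = (\<Sum>U\<in>Pow ?S. \<Sum>V\<in>Pow ?S. \<bar>real (card U) - real (card V)\<bar>)"
    unfolding ball_count_def using card_mono[OF finite_lessThan[of n]]
    by (intro sum_abs_diff_thresholds[symmetric]) fastforce
  also have "\<dots> = binomial_sum n (\<lambda>a. binomial_sum n (\<lambda>b. \<bar>real a - real b\<bar>))"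
    using sum_Pow_card[OF finite_lessThan[of n], of "\<lambda>b. \<bar>real _ - real b\<bar>"]
      sum_Pow_card[OF finite_lessThan[of n], of "\<lambda>a. binomial_sum n (\<lambda>b. \<bar>real a - real b\<bar>)"]
    by simp
  \<comment> \<open>Complementing the second set makes the summand a function of
    \<open>a + b\<close>, so that the two sums merge into one over \<open>2n\<close>.\<close>
  also have "\<dots> = binomial_sum n (\<lambda>a. binomial_sum n (\<lambda>b. \<bar>real a - real (n - b)\<bar>))"
    using binomial_sum_reflect[of n "\<lambda>b. \<bar>real _ - real b\<bar>"] by simp
  also have "\<dots> = binomial_sum n (\<lambda>a. binomial_sum n (\<lambda>b. \<bar>2 * real (a + b) - real (2 * n)\<bar> / 2))"
    unfolding binomial_sum_def by (intro sum.cong refl arg_cong2[of _ _ _ _ "(*)"]) (auto simp: abs_if)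
  also have "\<dots> = binomial_sum (n + n) (\<lambda>c. \<bar>2 * real c - real (2 * n)\<bar> / 2)"
    by (rule binomial_sum_add)
  also have "\<dots> = binomial_sum (2 * n) (\<lambda>c. \<bar>2 * real c - real (2 * n)\<bar>) / 2"
    unfolding binomial_sum_def mult_2 by (simp add: sum_divide_distrib)
  also have "\<dots> = real n * real ((2 * n) choose n)"
    unfolding binomial_sum_abs by (simp add: central_def power_mult)
  finally show ?thesis
    by (simp add: card_Pow Lambda_def)
qed

subsection \<open>Walsh functions and Krawtchouk coefficients\<close>

definition walsh :: "'a set \<Rightarrow> 'a set \<Rightarrow> real" where
  "walsh A X = (-1) ^ card (A \<inter> X)"

lemma walsh_commute: "walsh A X = walsh X A"
  by (simp add: walsh_def Int_commute)

lemma walsh_empty [simp]: "walsh {} X = 1"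
  by (simp add: walsh_def)

lemma walsh_eq_prod:
  assumes "finite A"
  shows "walsh A X = (\<Prod>i\<in>A. if i \<in> X then -1 else 1)"
proof -
  have "(\<Prod>i\<in>A. if i \<in> X then -1 else (1::real)) = (\<Prod>i\<in>A \<inter> X. -1)"
    using assms by (simp add: prod.inter_restrict del: prod_constant)
  then show ?thesis by (simp add: walsh_def)
qed

lemma walsh_sym_diff:
  assumes "finite A"
  shows "walsh A (sym_diff X Y) = walsh A X * walsh A Y"
  unfolding walsh_eq_prod[OF assms] prod.distrib[symmetric] by (intro prod.cong refl) auto

text \<open>The sum is the expansion of a product over \<open>S\<close> with factors 1 plus a sign;
  any coordinate in \<open>X\<close> gives a factor 0.\<close>

lemma sum_walsh:
  assumes "finite S" "X \<subseteq> S"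
  shows "(\<Sum>A\<in>Pow S. walsh A X) = (if X = {} then 2 ^ card S else 0)"
proof -
  have "(\<Sum>A\<in>Pow S. walsh A X)
      = (\<Sum>A\<in>Pow S. (\<Prod>i\<in>A. if i \<in> X then -1 else 1) * (\<Prod>i\<in>S - A. 1))"
    using assms finite_subset[OF _ assms(1)] by (intro sum.cong refl) (auto simp: walsh_eq_prod)
  also have "\<dots> = (\<Prod>i\<in>S. (if i \<in> X then -1 else 1) + 1)"
    using assms by (subst prod_add) auto
  also have "\<dots> = (if X = {} then 2 ^ card S else 0)"
    using assms by (auto intro!: prod_zero)
  finally show ?thesis .
qed

lemma walsh_parseval:
  assumes "finite S"
  shows "(\<Sum>A\<in>Pow S. (\<Sum>U\<in>Pow S. F U * walsh A U)\<^sup>2) = 2 ^ card S * (\<Sum>U\<in>Pow S. (F U)\<^sup>2)"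
proof -
  have "(\<Sum>A\<in>Pow S. (\<Sum>U\<in>Pow S. F U * walsh A U)\<^sup>2)
      = (\<Sum>A\<in>Pow S. \<Sum>U\<in>Pow S. \<Sum>V\<in>Pow S. F U * F V * walsh A (sym_diff U V))"
    unfolding power2_eq_square sum_product using finite_subset[OF _ assms]
    by (intro sum.cong refl) (auto simp: walsh_sym_diff mult_ac)
  also have "\<dots> = (\<Sum>U\<in>Pow S. \<Sum>A\<in>Pow S. \<Sum>V\<in>Pow S. F U * F V * walsh A (sym_diff U V))"
    by (rule sum.swap)
  also have "\<dots> = (\<Sum>U\<in>Pow S. \<Sum>V\<in>Pow S. \<Sum>A\<in>Pow S. F U * F V * walsh A (sym_diff U V))"
    by (intro sum.cong refl sum.swap)
  also have "\<dots> = (\<Sum>U\<in>Pow S. \<Sum>V\<in>Pow S. if U = V then 2 ^ card S * (F U)\<^sup>2 else 0)"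
  proof (intro sum.cong refl)
    fix U V assume "U \<in> Pow S" "V \<in> Pow S"
    then have "(\<Sum>A\<in>Pow S. walsh A (sym_diff U V)) = (if U = V then 2 ^ card S else 0)"
      by (subst sum_walsh[OF assms]) auto
    then show "(\<Sum>A\<in>Pow S. F U * F V * walsh A (sym_diff U V))
        = (if U = V then 2 ^ card S * (F U)\<^sup>2 else 0)"
      unfolding sum_distrib_left[symmetric] by (auto simp: power2_eq_square)
  qed
  also have "\<dots> = 2 ^ card S * (\<Sum>U\<in>Pow S. (F U)\<^sup>2)"
    using assms by (simp add: sum_distrib_left)
  finally show ?thesis .
qed

lemma walsh_parseval_code:
  assumes "finite S" "W \<subseteq> Pow S"
  shows "(\<Sum>A\<in>Pow S. (\<Sum>X\<in>W. walsh A X)\<^sup>2) = 2 ^ card S * real (card W)"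
proof -
  have W: "Pow S \<inter> W = W" using assms by auto
  have "(\<Sum>U\<in>Pow S. of_bool (U \<in> W) * walsh A U) = (\<Sum>X\<in>W. walsh A X)" for A
    using assms sum.inter_restrict[of "Pow S" "walsh A" W]
    by (simp add: W of_bool_def if_distrib[of "\<lambda>c. c * _"] cong: if_cong)
  moreover have "(\<Sum>U\<in>Pow S. (of_bool (U \<in> W))\<^sup>2) = real (card W)"
    using assms sum.inter_restrict[of "Pow S" "\<lambda>_. 1 :: real" W]
    by (simp add: W of_bool_def if_distrib[of "\<lambda>c. c\<^sup>2"] cong: if_cong)
  ultimately show ?thesis
    using walsh_parseval[OF assms(1), of "\<lambda>U. of_bool (U \<in> W)"] by simp
qed

section \<open>Krawtchouk values as polynomial coefficients\<close>

definition krawtchouk_poly :: "nat \<Rightarrow> nat \<Rightarrow> real poly" where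
  "krawtchouk_poly m j = [:1, -1:] ^ j * [:1, 1:] ^ (m - j)"

lemma coeff_one_plus_power: "coeff ([:1, c:] ^ n) i = real (n choose i) * c ^ i" for c :: real
proof (cases "i \<le> n")
  case False
  then have "degree ([:1, c:] ^ n) < i"
    using degree_power_le[of "[:1, c:]" n] by (cases "c = 0") auto
  then show ?thesis
    using False by (simp add: coeff_eq_0 binomial_eq_0)
qed (simp add: coeff_linear_poly_power)

text \<open>\<open>krawtchouk_poly m j\<close> is the generating function of the Krawtchouk values
  at \<open>j\<close>: convolving its two binomial expansions gives the defining sum.\<close>

lemma krawtchouk_eq_coeff:
  assumes "j \<le> m"
  shows "krawtchouk m s (real j) = coeff (krawtchouk_poly m j) s"
  unfolding krawtchouk_def krawtchouk_poly_def coeff_mult coeff_one_plus_power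
  using assms by (intro sum.cong refl) (simp add: binomial_gbinomial of_nat_diff)

text \<open>Reversing the coefficients fixes \<open>1 + z\<close> and negates \<open>1 - z\<close>,
  which occurs \<open>j\<close> times.\<close>

lemma coeff_krawtchouk_poly_symmetric:
  assumes "j \<le> m" "s \<le> m"
  shows "coeff (krawtchouk_poly m j) (m - s) = (-1) ^ j * coeff (krawtchouk_poly m j) s"
proof -
  let ?p = "krawtchouk_poly m j"
  have deg: "degree ?p = m"
    using assms by (simp add: krawtchouk_poly_def degree_mult_eq degree_power_eq)
  have "reflect_poly [:1, -1 :: real:] = smult (-1) [:1, -1:]" "reflect_poly [:1, 1 :: real:] = [:1, 1:]"
    by (simp_all add: reflect_poly_pCons)
  then have "reflect_poly ?p = smult ((-1) ^ j) ?p"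
    unfolding krawtchouk_poly_def reflect_poly_mult reflect_poly_power
    by (simp only: smult_power mult_smult_left)
  moreover have "coeff (reflect_poly ?p) s = coeff ?p (m - s)"
    using assms deg by (simp add: coeff_reflect_poly)
  ultimately show ?thesis by simp
qed

text \<open>Substituting \<open>-z\<close> for \<open>z\<close> exchanges the factors
  \<open>1 - z\<close> and \<open>1 + z\<close>.\<close>

lemma coeff_krawtchouk_poly_minus:
  assumes "j \<le> m"
  shows "coeff (krawtchouk_poly m (m - j)) s = (-1) ^ s * coeff (krawtchouk_poly m j) s"
proof -
  have pow: "pcompose (p ^ k) [:0, -1:] = pcompose p [:0, -1:] ^ k" for p :: "real poly" and k
    by (induction k) (simp_all add: pcompose_1 pcompose_mult)
  have "pcompose (krawtchouk_poly m j) [:0, -1:] = krawtchouk_poly m (m - j)"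
    using assms by (simp add: krawtchouk_poly_def pcompose_mult pow pcompose_pCons mult.commute)
  then show ?thesis
    by (metis coeff_pcompose_linear)
qed

lemma coeff_one_minus_square_power:
  "coeff ([:1, 0, -1 :: real:] ^ m) (2 * h) = (-1) ^ h * real (m choose h)"
proof -
  have "[:1, 0, -1 :: real:] = monom (-1) 2 + 1"
    by (simp add: monom_altdef power2_eq_square one_pCons)
  then have "[:1, 0, -1 :: real:] ^ m = (\<Sum>k\<le>m. of_nat (m choose k) * monom (-1) 2 ^ k)"
    by (simp only: binomial_ring power_one mult_1_right)
  then have "coeff ([:1, 0, -1 :: real:] ^ m) (2 * h)
      = (\<Sum>k\<le>m. real (m choose k) * (if k = h then (-1) ^ k else 0))"
    by (simp add: coeff_sum monom_power of_nat_poly)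
  also have "\<dots> = (\<Sum>k\<le>m. if k = h then (-1) ^ h * real (m choose h) else 0)"
    by (intro sum.cong) auto
  finally show ?thesis
    by (simp add: binomial_eq_0)
qed

text \<open>By palindromy the alternating sum is, up to sign, the middle coefficient of
  \<open>q(z) q(-z) = (1 - z\<^sup>2)\<^sup>m\<close> with \<open>q(z) = (1 - z)\<^sup>j (1 + z)\<^sup>m\<^sup>-\<^sup>j\<close>.\<close>

lemma alternating_sum_krawtchouk_squares:
  assumes "j \<le> 2 * h"
  shows "\<bar>\<Sum>s\<le>2 * h. (-1) ^ s * (coeff (krawtchouk_poly (2 * h) j) s)\<^sup>2\<bar> = real ((2 * h) choose h)"
proof -
  let ?m = "2 * h"
  let ?p = "krawtchouk_poly ?m j"
  have "krawtchouk_poly ?m (?m - j) * ?p = ([:1, -1:] * [:1, 1:]) ^ ?m"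
  proof -
    have "krawtchouk_poly ?m (?m - j) * ?p
        = ([:1, -1:] ^ (?m - j) * [:1, -1:] ^ j) * ([:1, 1:] ^ j * [:1, 1:] ^ (?m - j))"
      using assms by (simp add: krawtchouk_poly_def mult_ac)
    then show ?thesis
      using assms by (simp only: power_add[symmetric] power_mult_distrib) simp
  qed
  also have "[:1, -1:] * [:1, 1:] = [:1, 0, -1 :: real:]" by simp
  finally have "(-1) ^ h * real (?m choose h) = coeff (krawtchouk_poly ?m (?m - j) * ?p) ?m"
    by (simp add: coeff_one_minus_square_power)
  also have "\<dots> = (\<Sum>s\<le>?m. (-1) ^ j * ((-1) ^ s * (coeff ?p s)\<^sup>2))"
    unfolding coeff_mult using assms
    by (intro sum.cong refl)
      (simp add: coeff_krawtchouk_poly_minus coeff_krawtchouk_poly_symmetric power2_eq_square)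
  finally have "(\<Sum>s\<le>?m. (-1) ^ s * (coeff ?p s)\<^sup>2) * (-1) ^ j = (-1) ^ h * real (?m choose h)"
    by (simp add: sum_distrib_left mult.commute)
  from arg_cong[OF this, of abs] show ?thesis
    by (simp add: abs_mult power_abs)
qed

text \<open>Triangle inequality for the alternating sum, whose absolute value is the same for every
  \<open>j\<close>.\<close>

lemma sum_krawtchouk_squares_ge:
  assumes "j \<le> 2 * h"
  shows "real ((2 * h) choose h) \<le> (\<Sum>s\<le>2 * h. (coeff (krawtchouk_poly (2 * h) j) s)\<^sup>2)"
  unfolding alternating_sum_krawtchouk_squares[OF assms, symmetric]
  by (rule order_trans[OF sum_abs]) (simp add: abs_mult power_abs)

text \<open>For \<open>j = h\<close> the polynomial is even, so its odd coefficients vanish and the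
  alternating signs have no effect.\<close>

lemma sum_krawtchouk_squares_middle:
  "(\<Sum>s\<le>2 * h. (coeff (krawtchouk_poly (2 * h) h) s)\<^sup>2) = real ((2 * h) choose h)"
proof -
  let ?p = "krawtchouk_poly (2 * h) h"
  have "(-1) ^ s * coeff ?p s = coeff ?p s" for s
    using coeff_krawtchouk_poly_minus[of h "2 * h" s] by simp
  then have "(-1) ^ s * (coeff ?p s)\<^sup>2 = (coeff ?p s)\<^sup>2" for s
    by (metis mult.assoc power2_eq_square)
  then have "\<bar>\<Sum>s\<le>2 * h. (coeff ?p s)\<^sup>2\<bar> = real ((2 * h) choose h)"
    using alternating_sum_krawtchouk_squares[of h h] by (simp only: order_refl)
  then show ?thesis
    by (simp add: sum_nonneg)
qed

section \<open>Fourier coefficients of Hamming balls\<close>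

definition ball_walsh :: "nat \<Rightarrow> nat \<Rightarrow> nat set \<Rightarrow> real" where
  "ball_walsh n t A = (\<Sum>V\<in>Pow {..<n}. of_bool (card V \<le> t) * walsh A V)"

lemma ball_walsh_empty: "ball_walsh n t {} = ball_count n t"
  by (simp add: ball_walsh_def ball_count_def)

text \<open>Spheres have the generating function \<open>(1 - z)^|A| (1 + z)^(n - |A|)\<close>.
  Passing to balls divides by \<open>1 - z\<close>, which cancels one factor because
  \<open>A\<close> is nonempty; hence the shifts to \<open>n - 1\<close> and
  \<open>card A - 1\<close>.\<close>

lemma ball_walsh_eq_coeff:
  assumes "A \<subseteq> {..<n}" "A \<noteq> {}"
  shows "ball_walsh n t A = coeff (krawtchouk_poly (n - 1) (card A - 1)) t"
proof -
  let ?S = "{..<n}"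
  let ?q = "krawtchouk_poly (n - 1) (card A - 1)"
  define p where "p = (\<Sum>V\<in>Pow ?S. monom (walsh A V) (card V))"
  have finA: "finite A" and A: "1 \<le> card A" "card A \<le> n"
    using assms finite_subset[OF assms(1)] card_mono[OF _ assms(1)]
    by (auto simp: Suc_le_eq card_gt_0_iff)
  \<comment> \<open>The sum over \<open>V\<close> is the expansion of a product with one factor
    \<open>1 - z\<close> or \<open>1 + z\<close> per coordinate.\<close>
  have "p = (\<Sum>V\<in>Pow ?S. (\<Prod>i\<in>V. monom (if i \<in> A then -1 else 1) 1) * (\<Prod>i\<in>?S - V. 1))"
    unfolding p_def
  proof (intro sum.cong refl)
    fix V assume "V \<in> Pow ?S"
    then have "finite V" using finite_subset by auto
    then have "(\<Prod>i\<in>V. monom (if i \<in> A then -1 else 1 :: real) 1) = monom (walsh V A) (card V)"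
      unfolding walsh_eq_prod[OF \<open>finite V\<close>]
      by (induction V rule: finite_induct) (auto simp: mult_monom monom_0)
    then show "monom (walsh A V) (card V)
        = (\<Prod>i\<in>V. monom (if i \<in> A then -1 else 1) 1) * (\<Prod>i\<in>?S - V. 1)"
      by (simp add: walsh_commute)
  qed
  also have "\<dots> = (\<Prod>i\<in>?S. monom (if i \<in> A then -1 else 1) 1 + 1)"
    by (subst prod_add) auto
  also have "\<dots> = (\<Prod>i\<in>?S. if i \<in> A then [:1, -1:] else [:1, 1:])"
    by (intro prod.cong refl) (auto simp: monom_altdef one_pCons)
  also have "\<dots> = [:1, -1:] ^ card A * [:1, 1:] ^ (n - card A)"
  proof -
    have "?S \<inter> {i. i \<in> A} = A" "?S \<inter> - {i. i \<in> A} = ?S - A" using assms by auto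
    then show ?thesis
      using assms finA by (simp add: prod.If_cases card_Diff_subset)
  qed
  also have "\<dots> = [:1, -1:] * ?q"
    using A by (cases "card A") (simp_all add: krawtchouk_poly_def mult.assoc del: mult_pCons_left)
  finally have p: "p = [:1, -1:] * ?q" .
  \<comment> \<open>Coefficients of \<open>(1 - z) q\<close> are consecutive differences of those of
    \<open>q\<close>, so the sum telescopes.\<close>
  have coeff_p: "(\<Sum>s\<le>t. coeff p s) = coeff ?q t" for t
    by (induction t) (simp_all add: p coeff_pCons)
  have "(\<Sum>s\<le>t. coeff p s) = (\<Sum>s\<le>t. \<Sum>V\<in>Pow ?S. if card V = s then walsh A V else 0)"
    by (simp add: p_def coeff_sum)
  also have "\<dots> = (\<Sum>V\<in>Pow ?S. \<Sum>s\<le>t. if card V = s then walsh A V else 0)"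
    by (rule sum.swap)
  also have "\<dots> = ball_walsh n t A"
    unfolding ball_walsh_def by (intro sum.cong refl) (simp add: sum.delta')
  finally show ?thesis
    using coeff_p by simp
qed

text \<open>The ball count is the convolution of the indicators of the code and of the ball, so its
  transform is a product.\<close>

lemma walsh_code_ball_count:
  assumes "W \<subseteq> Pow {..<n}" "finite A"
  shows "(\<Sum>U\<in>Pow {..<n}. code_ball_count W t U * walsh A U)
    = (\<Sum>X\<in>W. walsh A X) * ball_walsh n t A"
proof -
  have "(\<Sum>U\<in>Pow {..<n}. code_ball_count W t U * walsh A U)
      = (\<Sum>X\<in>W. \<Sum>U\<in>Pow {..<n}. of_bool (card (sym_diff X U) \<le> t) * walsh A U)"
    unfolding code_ball_count_def sum_distrib_right by (rule sum.swap)
  also have "\<dots> = (\<Sum>X\<in>W. walsh A X * ball_walsh n t A)"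
  proof (intro sum.cong refl)
    fix X assume X: "X \<in> W"
    have sq: "walsh A X * walsh A X = 1"
      by (simp add: walsh_def flip: power_mult_distrib)
    have "(\<Sum>U\<in>Pow {..<n}. of_bool (card (sym_diff X U) \<le> t) * walsh A U)
        = (\<Sum>U\<in>Pow {..<n}. walsh A X * (of_bool (card (sym_diff X U) \<le> t) * walsh A (sym_diff X U)))"
      using sq by (intro sum.cong refl) (simp add: walsh_sym_diff[OF assms(2)])
    also have "\<dots> = walsh A X * ball_walsh n t A"
      unfolding sum_distrib_left[symmetric] ball_walsh_def using X assms(1)
      by (subst sum_Pow_sym_diff[where h="\<lambda>V. of_bool (card V \<le> t) * walsh A V"]) auto
    finally show "(\<Sum>U\<in>Pow {..<n}. of_bool (card (sym_diff X U) \<le> t) * walsh A U)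
        = walsh A X * ball_walsh n t A" .
  qed
  finally show ?thesis by (simp add: sum_distrib_right)
qed

subsection \<open>The bounds\<close>

lemma sum_lam_le_spectral:
  assumes W: "W \<subseteq> Pow {..<n}" and n: "n = 2 * h + 1"
  shows "(\<Sum>X\<in>W. \<Sum>Y\<in>W. lam n (card (sym_diff X Y)))
    \<le> (real (card W))\<^sup>2 * Lambda n
      - real ((2 * h) choose h) * (2 ^ n * real (card W) - (real (card W))\<^sup>2) / 2 ^ n"
proof -
  let ?S = "{..<n}" and ?N = "real (card W)" and ?C = "real ((2 * h) choose h)"
  define z where "z A = (\<Sum>X\<in>W. walsh A X)" for A
  have z0: "z {} = ?N" by (simp add: z_def)
  have split: "(\<Sum>A\<in>Pow ?S. f A) = f {} + (\<Sum>A\<in>Pow ?S - {{}}. f A)" for f :: "nat set \<Rightarrow> real"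
    by (rule sum.remove) auto
  have square: "2 ^ n * (\<Sum>U\<in>Pow ?S. (code_ball_count W t U)\<^sup>2)
      = (?N * ball_count n t)\<^sup>2 + (\<Sum>A\<in>Pow ?S - {{}}. (z A)\<^sup>2 * (ball_walsh n t A)\<^sup>2)" for t
  proof -
    have "2 ^ n * (\<Sum>U\<in>Pow ?S. (code_ball_count W t U)\<^sup>2)
        = (\<Sum>A\<in>Pow ?S. (\<Sum>U\<in>Pow ?S. code_ball_count W t U * walsh A U)\<^sup>2)"
      by (simp add: walsh_parseval)
    also have "\<dots> = (\<Sum>A\<in>Pow ?S. (z A)\<^sup>2 * (ball_walsh n t A)\<^sup>2)"
      using finite_subset[of _ ?S]
      by (intro sum.cong refl) (auto simp: walsh_code_ball_count[OF W] z_def power_mult_distrib)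
    finally show ?thesis
      by (simp add: split z0 ball_walsh_empty power_mult_distrib)
  qed
  have ge: "?C \<le> (\<Sum>t<n. (ball_walsh n t A)\<^sup>2)" if "A \<in> Pow ?S - {{}}" for A
  proof -
    have "card A \<le> n" using that card_mono[of ?S A] by auto
    then show ?thesis
      using that sum_krawtchouk_squares_ge[of "card A - 1" h] n
      by (simp add: ball_walsh_eq_coeff lessThan_Suc_atMost)
  qed
  \<comment> \<open>By Parseval for the code, the nonempty frequencies carry total squared mass
    \<open>2 ^ n * ?N - ?N\<^sup>2\<close>.\<close>
  have "?C * (2 ^ n * ?N - ?N\<^sup>2) = (\<Sum>A\<in>Pow ?S - {{}}. (z A)\<^sup>2 * ?C)"
    using walsh_parseval_code[OF _ W] split[of "\<lambda>A. (z A)\<^sup>2"] z0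
    by (simp add: z_def[symmetric] sum_distrib_right[symmetric])
  also have "\<dots> \<le> (\<Sum>A\<in>Pow ?S - {{}}. (z A)\<^sup>2 * (\<Sum>t<n. (ball_walsh n t A)\<^sup>2))"
    by (intro sum_mono mult_left_mono ge) auto
  also have "\<dots> = (\<Sum>t<n. \<Sum>A\<in>Pow ?S - {{}}. (z A)\<^sup>2 * (ball_walsh n t A)\<^sup>2)"
    unfolding sum_distrib_left by (rule sum.swap)
  \<comment> \<open>Adding and subtracting \<open>2 ^ n * ?N\<^sup>2 * ball_count n t\<close>
    separates the whole-cube sum from the discrepancy of \<open>W\<close>.\<close>
  also have "\<dots> = (\<Sum>t<n. ?N\<^sup>2 * (2 ^ n * ball_count n t - (ball_count n t)\<^sup>2)
      - 2 ^ n * (?N\<^sup>2 * ball_count n t - (\<Sum>U\<in>Pow ?S. (code_ball_count W t U)\<^sup>2)))"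
    by (intro sum.cong refl) (simp add: right_diff_distrib square power_mult_distrib)
  also have "\<dots> = ?N\<^sup>2 * (2 ^ n * Lambda n) - 2 ^ n * (\<Sum>X\<in>W. \<Sum>Y\<in>W. lam n (card (sym_diff X Y)))"
    unfolding sum_subtractf[where f = "\<lambda>t. ?N\<^sup>2 * _ t"] sum_distrib_left[symmetric]
      sum_ball_count sum_lam_eq_discrepancy[OF W] by simp
  finally show ?thesis
    by (simp add: field_simps)
qed

lemma sum_walsh_walsh_nonneg: "0 \<le> (\<Sum>X\<in>W. \<Sum>Y\<in>W. walsh A X * walsh A Y)"
  unfolding sum_product[symmetric] by (rule zero_le_square)

text \<open>\<open>n - 2w\<close> and \<open>(-1)\<^sup>w\<close> are the Krawtchouk polynomials of degree \<open>1\<close> and \<open>n\<close>.\<close>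

lemma sum_krawtchouk_1_n_nonneg:
  assumes W: "W \<subseteq> Pow {..<n}"
  shows "0 \<le> (\<Sum>X\<in>W. \<Sum>Y\<in>W. real n - 2 * real (card (sym_diff X Y)) + (-1) ^ card (sym_diff X Y))"
proof -
  let ?S = "{..<n}"
  have eq: "real n - 2 * real (card (sym_diff X Y)) + (-1) ^ card (sym_diff X Y)
      = (\<Sum>i<n. walsh {i} X * walsh {i} Y) + walsh ?S X * walsh ?S Y"
    if "X \<in> W" "Y \<in> W" for X Y
  proof -
    define D where "D = sym_diff X Y"
    have D: "?S \<inter> D = D" using that W by (auto simp: D_def)
    have "(\<Sum>i<n. walsh {i} X * walsh {i} Y) = (\<Sum>i<n. walsh {i} D)"
      unfolding D_def by (intro sum.cong refl walsh_sym_diff[symmetric]) auto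
    also have "\<dots> = (\<Sum>i<n. 1 - 2 * of_bool (i \<in> D))"
      by (intro sum.cong refl) (auto simp: walsh_def)
    also have "\<dots> = real n - 2 * (\<Sum>i<n. of_bool (i \<in> D))"
      by (simp only: sum_subtractf sum_distrib_left sum_constant card_lessThan mult_1_right)
    also have "(\<Sum>i<n. of_bool (i \<in> D)) = real (card (?S \<inter> D))"
      by (simp add: sum.If_cases of_bool_def Int_def)
    finally have "(\<Sum>i<n. walsh {i} X * walsh {i} Y) = real n - 2 * real (card D)"
      by (simp add: D)
    moreover have "walsh ?S X * walsh ?S Y = (-1) ^ card D"
      unfolding D_def walsh_sym_diff[OF finite_lessThan, symmetric] using D
      by (simp add: walsh_def D_def)
    ultimately show ?thesis by (simp add: D_def)
  qed
  have "(\<Sum>X\<in>W. \<Sum>Y\<in>W. real n - 2 * real (card (sym_diff X Y)) + (-1) ^ card (sym_diff X Y))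
      = (\<Sum>X\<in>W. \<Sum>Y\<in>W. (\<Sum>i<n. walsh {i} X * walsh {i} Y) + walsh ?S X * walsh ?S Y)"
    by (intro sum.cong refl eq)
  also have "\<dots> = (\<Sum>i<n. \<Sum>X\<in>W. \<Sum>Y\<in>W. walsh {i} X * walsh {i} Y)
      + (\<Sum>X\<in>W. \<Sum>Y\<in>W. walsh ?S X * walsh ?S Y)"
    unfolding sum.distrib by (simp add: sum.swap[of _ "{..<n}" W])
  also have "\<dots> \<ge> 0"
    by (intro add_nonneg_nonneg sum_nonneg[of "{..<n}"] sum_walsh_walsh_nonneg)
  finally show ?thesis .
qed

text \<open>The linear programming bound: the pair sum of the Krawtchouk part is nonnegative and
  enters with coefficient \<open>-b\<close>, so it may be dropped.\<close>

lemma sum_lam_le_linear: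
  assumes W: "W \<subseteq> Pow {..<n}" and b: "0 \<le> b"
    and le: "\<And>w. 1 \<le> w \<Longrightarrow> w \<le> n \<Longrightarrow> lam n w \<le> a - b * (real n - 2 * real w + (-1) ^ w)"
  shows "(\<Sum>X\<in>W. \<Sum>Y\<in>W. lam n (card (sym_diff X Y)))
    \<le> (real (card W))\<^sup>2 * a - real (card W) * (a - b * (real n + 1))"
proof -
  let ?K = "\<lambda>X Y. real n - 2 * real (card (sym_diff X Y)) + (-1) ^ card (sym_diff X Y)"
  have fin: "finite W" using W finite_subset by auto
  have "(\<Sum>X\<in>W. \<Sum>Y\<in>W. lam n (card (sym_diff X Y)))
      \<le> (\<Sum>X\<in>W. \<Sum>Y\<in>W. a - b * ?K X Y - (if X = Y then a - b * (real n + 1) else 0))"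
  proof (intro sum_mono)
    fix X Y assume XY: "X \<in> W" "Y \<in> W"
    show "lam n (card (sym_diff X Y)) \<le> a - b * ?K X Y - (if X = Y then a - b * (real n + 1) else 0)"
    proof (cases "X = Y")
      case False
      have sub: "sym_diff X Y \<subseteq> {..<n}" using XY W by auto
      then have "1 \<le> card (sym_diff X Y)"
        using False finite_subset[OF sub] by (auto simp: Suc_le_eq card_gt_0_iff)
      moreover have "card (sym_diff X Y) \<le> n"
        using card_mono[OF _ sub] by simp
      ultimately show ?thesis using le False by simp
    qed (simp add: lam_def)
  qed
  also have "\<dots> = (real (card W))\<^sup>2 * a - b * (\<Sum>X\<in>W. \<Sum>Y\<in>W. ?K X Y) - real (card W) * (a - b * (real n + 1))"
    using fin by (simp only: sum_subtractf sum_distrib_left[symmetric] sum_constant sum.delta' if_True cong: sum.cong)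
      (simp add: power2_eq_square algebra_simps)
  also have "\<dots> \<le> (real (card W))\<^sup>2 * a - real (card W) * (a - b * (real n + 1))"
    using mult_nonneg_nonneg[OF b sum_krawtchouk_1_n_nonneg[OF W]] by simp
  finally show ?thesis .
qed

section \<open>From points of the cube to families of subsets\<close>

definition support :: "nat \<Rightarrow> (nat \<Rightarrow> nat) \<Rightarrow> nat set" where
  "support n x = {i. i < n \<and> x i = 1}"

lemma cube_cases: "x \<in> cube n \<Longrightarrow> i < n \<Longrightarrow> x i = 0 \<or> x i = 1"
  by (auto simp: cube_def PiE_iff)

lemma inj_on_support: "inj_on (support n) (cube n)"
proof (rule inj_onI)
  fix x y assume xy: "x \<in> cube n" "y \<in> cube n" "support n x = support n y"
  show "x = y"
  proof (rule PiE_ext)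
    show "x \<in> {..<n} \<rightarrow>\<^sub>E {0, 1}" "y \<in> {..<n} \<rightarrow>\<^sub>E {0, 1}"
      using xy by (simp_all add: cube_def)
    fix i assume i: "i \<in> {..<n}"
    then have "x i = 1 \<longleftrightarrow> y i = 1" using xy(3) by (auto simp: support_def)
    then show "x i = y i"
      using cube_cases[OF xy(1)] cube_cases[OF xy(2)] i by (metis lessThan_iff)
  qed
qed

lemma hamming_eq_card_sym_diff:
  assumes "x \<in> cube n" "y \<in> cube n"
  shows "hamming n x y = card (sym_diff (support n x) (support n y))"
  unfolding hamming_def support_def
  using cube_cases[OF assms(1)] cube_cases[OF assms(2)] by (intro arg_cong[of _ _ card]) force

text \<open>The coding by supports is injective and preserves distances. \<open>energy\<close>
  divides by \<open>N\<close>, hence the factor \<open>real N\<close> in the premise.\<close>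

lemma max_energy_leI:
  assumes N: "1 \<le> N" "N \<le> 2 ^ n"
    and le: "\<And>W. W \<subseteq> Pow {..<n} \<Longrightarrow> card W = N \<Longrightarrow>
      (\<Sum>X\<in>W. \<Sum>Y\<in>W. lam n (card (sym_diff X Y))) \<le> real N * B"
  shows "max_energy n N \<le> B"
  unfolding max_energy_def
proof (subst Max_le_iff[OF max_energy_attained[OF N(2)]], safe)
  fix Z assume Z: "Z \<subseteq> cube n" "N = card Z"
  have inj: "inj_on (support n) Z"
    using inj_on_support Z(1) by (rule inj_on_subset)
  have "(\<Sum>x\<in>Z. \<Sum>y\<in>Z. lam n (hamming n x y))
      = (\<Sum>X\<in>support n ` Z. \<Sum>Y\<in>support n ` Z. lam n (card (sym_diff X Y)))"
    unfolding sum.reindex[OF inj] o_def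
    using Z by (intro sum.cong refl arg_cong[of _ _ "lam n"] hamming_eq_card_sym_diff) auto
  also have "\<dots> \<le> real N * B"
  proof (rule le)
    show "support n ` Z \<subseteq> Pow {..<n}" by (auto simp: support_def)
    show "card (support n ` Z) = N" using Z inj by (simp add: card_image)
  qed
  finally show "energy n Z \<le> B"
    using N Z(2) by (simp add: energy_def field_simps)
qed

lemma lam_le_tangent:
  assumes "w \<le> n"
  shows "lam n w \<le> 2 ^ n * central s * (4 * real s + real n + 1) / 8
    - 2 ^ n * central s / 8 * (real n - 2 * real w + (-1) ^ w)"
proof -
  define i where "i = (w + 1) div 2"
  \<comment> \<open>The parity term makes the expression affine in \<open>i\<close>, so the tangent
    line in \<open>i\<close> becomes a combination of the two Krawtchouk polynomials.\<close>
  have eq: "real n - 2 * real w + (-1) ^ w = real n + 1 - 4 * real i"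
    by (cases "even w") (auto simp: i_def elim!: evenE oddE)
  have "2 ^ n * (central s * (real s + real i) / 2)
      = 2 ^ n * central s * (4 * real s + real n + 1) / 8
        - 2 ^ n * central s / 8 * (real n - 2 * real w + (-1) ^ w)"
    unfolding eq by (simp add: field_simps)
  moreover have "2 ^ n * (real i * central i) \<le> 2 ^ n * (central s * (real s + real i) / 2)"
    by (intro mult_left_mono central_tangent) auto
  ultimately show ?thesis
    by (simp only: lam_eq_central[OF assms] i_def)
qed

lemma max_energy_le_lam_top:
  assumes "1 \<le> N" "N \<le> 2 ^ n"
  shows "max_energy n N \<le> (real N - 1) * lam n n"
proof (rule max_energy_leI[OF assms])
  fix W assume W: "W \<subseteq> Pow {..<n}" "card W = N"
  \<comment> \<open>Monotonicity allows a constant majorant, that is \<open>b = 0\<close>.\<close>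
  have "lam n w \<le> lam n n - 0 * (real n - 2 * real w + (-1) ^ w)" if "w \<le> n" for w
    using that by (auto simp: lam_eq_central div_le_mono intro!: central_weighted_mono)
  from sum_lam_le_linear[OF W(1) _ this]
  show "(\<Sum>X\<in>W. \<Sum>Y\<in>W. lam n (card (sym_diff X Y))) \<le> real N * ((real N - 1) * lam n n)"
    using W(2) by (simp add: power2_eq_square algebra_simps)
qed

lemma max_energy_le_middle:
  assumes N: "1 \<le> N" "N \<le> 2 ^ n" and t: "1 \<le> t" and n: "n = 2 * t - 1"
  shows "max_energy n N \<le> (if even t then lam n t * (real N - 1 / 2)
      else lam n t / (real n + 1) * (real N * real n - (real n - 1) / 2))"
proof -
  \<comment> \<open>As \<open>n + 1 = 2t\<close>, the expression \<open>n + 1 - 4i\<close> vanishes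
    at \<open>i = t / 2\<close>. The line for \<open>s\<close> touches there if \<open>t\<close> is
    even, and at both neighbours \<open>s\<close> and \<open>s + 1\<close> if \<open>t\<close> is
    odd.\<close>
  define s where "s = t div 2"
  define c where "c = 2 ^ n * central s"
  have c: "0 \<le> c" using central_pos[of s] by (simp add: c_def)
  have "t \<le> n" using n t by simp
  then have lam: "lam n t = 2 ^ n * (real ((t + 1) div 2) * central ((t + 1) div 2))"
    by (rule lam_eq_central)
  \<comment> \<open>The linear bound reads \<open>a (N - 1) + b (n + 1)\<close> after division by
    \<open>N\<close>, with \<open>b = c / 8\<close>.\<close>
  have "max_energy n N \<le> c * (4 * real s + real n + 1) / 8 * (real N - 1) + c / 8 * (real n + 1)"
  proof (rule max_energy_leI[OF N])
    fix W assume W: "W \<subseteq> Pow {..<n}" "card W = N"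
    have "(\<Sum>X\<in>W. \<Sum>Y\<in>W. lam n (card (sym_diff X Y)))
        \<le> (real N)\<^sup>2 * (c * (4 * real s + real n + 1) / 8)
          - real N * (c * (4 * real s + real n + 1) / 8 - c / 8 * (real n + 1))"
      unfolding W(2)[symmetric] c_def using W(1) c lam_le_tangent
      by (intro sum_lam_le_linear) (auto simp: c_def)
    then show "(\<Sum>X\<in>W. \<Sum>Y\<in>W. lam n (card (sym_diff X Y)))
        \<le> real N * (c * (4 * real s + real n + 1) / 8 * (real N - 1) + c / 8 * (real n + 1))"
      by (simp add: power2_eq_square field_simps)
  qed
  also have "\<dots> = (if even t then lam n t * (real N - 1 / 2)
      else lam n t / (real n + 1) * (real N * real n - (real n - 1) / 2))"
  proof (cases "even t")
    case True
    then have s: "t = 2 * s" by (auto simp: s_def)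
    then have lam': "lam n t = c * real s"
      unfolding lam by (simp add: c_def)
    have rn: "real n = 4 * real s - 1" using n t s by simp
    show ?thesis
      unfolding lam' rn using True by (simp add: field_simps)
  next
    case False
    then have s: "t = 2 * s + 1" by (auto simp: s_def elim: oddE)
    \<comment> \<open>For odd \<open>t\<close> the value \<open>lam n t\<close> belongs to the
      second contact point \<open>s + 1\<close>; the increment formula expresses it through
      \<open>central s\<close>.\<close>
    then have "(t + 1) div 2 = Suc s" by simp
    then have lam': "lam n t = c * (2 * real s + 1) / 2"
      by (simp only: lam central_weighted_Suc) (simp add: c_def field_simps)
    have rn: "real n = 4 * real s + 1" using n s by simp
    have "c * (2 * real s + 1) / 2 / (4 * real s + 1 + 1) = c / 4"
      by (simp add: divide_simps)
    then show ?thesis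
      unfolding lam' rn using False by (simp add: field_simps)
  qed
  finally show ?thesis .
qed

text \<open>\<open>lam_hat\<close> evaluates at \<open>k - 1\<close>, so \<open>k = h + 1\<close>
  hits the midpoint \<open>h\<close> of \<open>n - 1 = 2h\<close>, where the lower bound on the sum
  of squares is attained.\<close>

lemma lam_hat_middle:
  assumes "n = 2 * h + 1"
  shows "lam_hat n (h + 1) = - real ((2 * h) choose h) / 2 ^ n"
proof -
  have "(\<Sum>s<n. (krawtchouk (n - 1) s (real h))\<^sup>2) = real ((2 * h) choose h)"
    using sum_krawtchouk_squares_middle[of h] assms
    by (simp add: krawtchouk_eq_coeff lessThan_Suc_atMost)
  then show ?thesis by (simp add: lam_hat_def)
qed

theorem theorem5p2:
  fixes n N :: nat
  assumes "1 \<le> N" and "N \<le> 2 ^ n"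
  shows "max_energy n N \<le> (real N - 1) * lam n n
    \<and> (\<forall>t\<ge>1. n = 2 * t - 1 \<longrightarrow>
         max_energy n N \<le>
           (if even t then lam n t * (real N - 1 / 2)
            else lam n t / (real n + 1) * (real N * real n - (real n - 1) / 2)))
    \<and> (odd n \<longrightarrow>
         max_energy n N \<le> real N * lam_hat n 0 + (2 ^ n - real N) * lam_hat n ((n + 1) div 2)
         \<and> real N * lam_hat n 0 + (2 ^ n - real N) * lam_hat n ((n + 1) div 2)
             = real N * Lambda n - (1 - real N / 2 ^ n) * real ((n - 1) choose ((n - 1) div 2)))"
proof (intro conjI allI impI)
  show "max_energy n N \<le> (real N - 1) * lam n n"
    using assms by (rule max_energy_le_lam_top)
  show "max_energy n N \<le> (if even t then lam n t * (real N - 1 / 2)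
      else lam n t / (real n + 1) * (real N * real n - (real n - 1) / 2))"
    if "1 \<le> t" "n = 2 * t - 1" for t
    using assms that by (rule max_energy_le_middle)
  assume "odd n"
  then obtain h where n: "n = 2 * h + 1" by (elim oddE)
  have half: "(n + 1) div 2 = h + 1" "(n - 1) choose ((n - 1) div 2) = (2 * h) choose h"
    using n by simp_all
  let ?C = "real ((2 * h) choose h)"
  have lam_hat_0: "lam_hat n 0 = Lambda n" by (simp add: lam_hat_def)
  show eq: "real N * lam_hat n 0 + (2 ^ n - real N) * lam_hat n ((n + 1) div 2)
      = real N * Lambda n - (1 - real N / 2 ^ n) * real ((n - 1) choose ((n - 1) div 2))"
    unfolding half lam_hat_0 lam_hat_middle[OF n] by (simp add: field_simps)
  show "max_energy n N \<le> real N * lam_hat n 0 + (2 ^ n - real N) * lam_hat n ((n + 1) div 2)"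
    unfolding eq unfolding half(2)
  proof (rule max_energy_leI[OF assms])
    fix W assume W: "W \<subseteq> Pow {..<n}" "card W = N"
    have "real N * (real N * Lambda n - (1 - real N / 2 ^ n) * ?C)
        = (real N)\<^sup>2 * Lambda n - ?C * (2 ^ n * real N - (real N)\<^sup>2) / 2 ^ n"
      by (simp add: field_simps power2_eq_square)
    then show "(\<Sum>X\<in>W. \<Sum>Y\<in>W. lam n (card (sym_diff X Y)))
        \<le> real N * (real N * Lambda n - (1 - real N / 2 ^ n) * ?C)"
      using sum_lam_le_spectral[OF W(1) n] W(2) by simp
  qed
qed

end
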